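(* Let $\mathcal H$ be a real Hilbert space, let $A\colon\mathcal H\to 2^{\mathcal H}$ and $B\colon\mathcal H\to 2^{\mathcal H}$ be maximally monotone operators such that $\operatorname{zer}(A+B)\neq\varnothing$, and let $\gamma\in\,]0,+\infty[$. Let $(a_n)_{n\in\mathbb N}$ and $(b_n)_{n\in\mathbb N}$ be sequences in $\mathcal H$ such that $\sum_{n\in\mathbb N}\|a_n\|<+\infty$ and $\sum_{n\in\mathbb N}\|b_n\|<+\infty$, let $x_0\in\mathcal H$, and let $(\mu_{n,j})_{n\in\mathbb N,\,0\leq j\leq n}$ be an array in $[0,+\infty[$ such that: (A1) $\sup_{n\in\mathbb N}\sum_{j=0}^n|\mu_{n,j}|<+\infty$; (A2) for every $n\in\mathbb N$, $\sum_{j=0}^n\mu_{n,j}=1$; (A3) for every $j\in\mathbb N$, $\lim_{n\to+\infty}\mu_{n,j}=0$; (A4) every sequence $(\xi_n)_{n\in\mathbb N}$ in $[0,+\infty[$ for which there exists a sequence $(\varepsilon_n)_{n\in\mathbb N}$ in $[0,+\infty[$ with $\sum_{n\in\mathbb N}\varepsilon_n<+\infty$ and $\xi_{n+1}\leq\sum_{j=0}^n\mu_{n,j}\xi_j+\varepsilon_n$ for all $n\in\mathbb N$, converges; (A5) $\inf_{n\in\mathbb N}\mu_{n+1,n}\,\mu_{n+1,n+1}>0$. For $n=0,1,\ldots$ iterate $$\begin{cases}\overline x_n=\sum_{j=0}^n\mu_{n,j}x_j\\ y_n=J_{\gamma B}\overline x_n+b_n\\ z_n=J_{\gamma A}(2y_n-\overline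 x_n)+a_n\\ x_{n+1}=\overline x_n+2(z_n-y_n).\end{cases}$$ Then there exists $x\in\operatorname{Fix}R_{\gamma A}R_{\gamma B}$ such that $x_n\rightharpoonup x$ and $\overline x_n\rightharpoonup x$. Moreover, setting $y=J_{\gamma B}x$, one has $y\in\operatorname{zer}(A+B)$, $z_n-y_n\to 0$, $y_n\rightharpoonup y$, and $z_n\rightharpoonup y$.
   Context: $\mathbb N=\{0,1,2,\ldots\}$; $\rightharpoonup$ and $\to$ denote weak and strong convergence in $\mathcal H$. For a set-valued operator $A\colon\mathcal H\to 2^{\mathcal H}$: $\operatorname{zer}A=\{x\in\mathcal H: 0\in Ax\}$; $\operatorname{gra}A=\{(x,u)\in\mathcal H\times\mathcal H: u\in Ax\}$; $A$ is monotone if $\langle x-y\mid u-v\rangle\geq 0$ for all $(x,u),(y,v)\in\operatorname{gra}A$, and maximally monotone if moreover no monotone operator has a graph properly containing $\operatorname{gra}A$. The resolvent of $A$ is $J_A=(\operatorname{Id}+A)^{-1}$ (single-valued and defined on all of $\mathcal H$ when $A$ is maximally monotone), and the reflector is $R_A=2J_A-\operatorname{Id}$. $\operatorname{Fix}T$ is the fixed point set of $T\colon\mathcal H\to\mathcal H$, and $R_{\gamma A}R_{\gamma B}$ denotes composition. *)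

theory Defs
  imports "HOL-Analysis.Analysis"
begin

text \<open>
  A real Hilbert space is a type of sort \<open>{real_inner, complete_space}\<close>; a set-valued
  operator on it is a function \<open>'a \<Rightarrow> 'a set\<close>.
\<close>

definition gra :: "('a \<Rightarrow> 'b set) \<Rightarrow> ('a \<times> 'b) set" where
  "gra A = {(x, u). u \<in> A x}"

definition zer :: "('a \<Rightarrow> 'b::zero set) \<Rightarrow> 'a set" where
  "zer A = {x. 0 \<in> A x}"

definition op_plus :: "('a \<Rightarrow> 'b::plus set) \<Rightarrow> ('a \<Rightarrow> 'b set) \<Rightarrow> 'a \<Rightarrow> 'b set" where
  "op_plus A B x = {u + v | u v. u \<in> A x \<and> v \<in> B x}"

definition op_scale :: "real \<Rightarrow> ('a \<Rightarrow> 'b::real_vector set) \<Rightarrow> 'a \<Rightarrow> 'b set" where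
  "op_scale \<gamma> A x = (\<lambda>u. \<gamma> *\<^sub>R u) ` A x"

definition op_id :: "'a \<Rightarrow> 'a set" where
  "op_id x = {x}"

definition op_inverse :: "('a \<Rightarrow> 'b set) \<Rightarrow> 'b \<Rightarrow> 'a set" where
  "op_inverse A u = {x. u \<in> A x}"

definition monotone_operator :: "('a::real_inner \<Rightarrow> 'a set) \<Rightarrow> bool" where
  "monotone_operator A \<longleftrightarrow>
     (\<forall>(x, u)\<in>gra A. \<forall>(y, v)\<in>gra A. inner (x - y) (u - v) \<ge> 0)"

definition maximally_monotone :: "('a::real_inner \<Rightarrow> 'a set) \<Rightarrow> bool" where
  "maximally_monotone A \<longleftrightarrow>
     monotone_operator A \<and> \<not> (\<exists>C. monotone_operator C \<and> gra A \<subset> gra C)"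

text \<open>
  \<open>resolvent A\<close> is the point-valued version of \<open>(Id + A)\<inverse>\<close>. It is meaningful where the latter
  is a singleton, which for maximally monotone \<open>A\<close> is the whole space by Minty's theorem;
  elsewhere its value is unspecified.
\<close>

definition resolvent :: "('a::real_inner \<Rightarrow> 'a set) \<Rightarrow> 'a \<Rightarrow> 'a" where
  "resolvent A x = the_elem (op_inverse (op_plus op_id A) x)"

definition reflector :: "('a::real_inner \<Rightarrow> 'a set) \<Rightarrow> 'a \<Rightarrow> 'a" where
  "reflector A x = 2 *\<^sub>R resolvent A x - x"

definition Fix :: "('a \<Rightarrow> 'a) \<Rightarrow> 'a set" where
  "Fix T = {x. T x = x}"

text \<open>
  The weak topology of a Hilbert space is the initial topology of the functionals
  \<open>\<lambda>z. inner z u\<close>, so weak convergence of a sequence is convergence under each of them.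
\<close>

definition weakly_converges :: "(nat \<Rightarrow> 'a::real_inner) \<Rightarrow> 'a \<Rightarrow> bool"
    (infix "\<rightharpoonup>" 55) where
  "X \<rightharpoonup> l \<longleftrightarrow> (\<forall>u. (\<lambda>n. inner (X n) u) \<longlonglongrightarrow> inner l u)"

end

theory Submission
  imports Defs
begin

text \<open>
  Write \<open>T\<close> for the composition of the two reflectors. Substituting the definitions turns the
  iteration into \<open>x\<^sub>n\<^sub>+\<^sub>1 = T (xbar\<^sub>n) + e\<^sub>n\<close> with \<open>\<parallel>e\<^sub>n\<parallel> \<le> 2 \<parallel>a\<^sub>n\<parallel> + 2 \<parallel>b\<^sub>n\<parallel>\<close>, and \<open>T\<close> is nonexpansive but
  no better: plain iteration of \<open>T\<close> need not converge, and it is the averaging that forces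
  \<open>T (xbar\<^sub>n) - xbar\<^sub>n \<rightarrow> 0\<close>. For a fixed point \<open>p\<close> of \<open>T\<close>, the distances \<open>\<parallel>x\<^sub>n - p\<parallel>\<close> satisfy the
  inequality in (A4), so they have a limit, and the weighted means of their squares and the
  squared distances \<open>\<parallel>xbar\<^sub>n - p\<parallel>\<^sup>2\<close> have the same limit. The difference of these two is the
  weighted variance of \<open>x\<^sub>0, \<dots>, x\<^sub>n\<close>, which therefore vanishes; as (A5) keeps the last two weights
  away from \<open>0\<close>, \<open>x\<^sub>n\<close> and \<open>x\<^sub>n\<^sub>-\<^sub>1\<close> both approach \<open>xbar\<^sub>n\<close>. This is lemma \<open>mean_iteration\<close>,
  and \<open>z\<^sub>n - y\<^sub>n = (x\<^sub>n\<^sub>+\<^sub>1 - xbar\<^sub>n) / 2 \<rightarrow> 0\<close> follows.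

  It remains to identify weak limits. Resolvents need not be weakly continuous, so the weak limit of
  \<open>J (xbar\<^sub>n)\<close>, \<open>J\<close> the resolvent of \<open>\<gamma>B\<close>, cannot be read off from that of \<open>xbar\<^sub>n\<close>. Instead,
  along any filter on which \<open>xbar\<^sub>n\<close> and \<open>J (xbar\<^sub>n)\<close> converge weakly, the monotonicity inequalities
  of \<open>A\<close> and \<open>B\<close> are added: the terms in which two weakly convergent factors meet cancel, and the
  limit inequality, tested at two resolvents, puts the limits into both graphs
  (\<open>weak_limit_in_both_graphs\<close>). Thus weak cluster points of \<open>xbar\<^sub>n\<close> are fixed points of \<open>T\<close>,
  Opial's argument gives weak convergence of \<open>xbar\<^sub>n\<close> to some \<open>x\<close>, and every weak cluster point of
  \<open>J (xbar\<^sub>n)\<close> is \<open>J x\<close>.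

  Two facts of Hilbert space theory carry this: Minty's theorem, without which the resolvents
  are unspecified, and the existence of weak cluster points, which rests on Riesz representation.
  Both Minty and Riesz come from one minimization principle, \<open>strong_convexity_minimum\<close>.
\<close>

section \<open>Minimization of a strongly convex function\<close>

text \<open>
  The function \<open>(a, s) \<mapsto> \<parallel>a\<parallel>\<^sup>2 - s\<close> is strongly convex in \<open>a\<close>, so by the parallelogram identity the
  first components of a minimizing sequence are Cauchy. Their limit \<open>c\<close> need not belong to a point
  of \<open>K\<close>, but the optimality condition of a minimizer, with the quadratic gain due to strong
  convexity, holds at \<open>c\<close> because it holds approximately along the sequence.
\<close>
lemma strong_convexity_minimum:
  fixes K :: "('a::{real_inner, complete_space} \<times> real) set"
  assumes "convex K" "K \<noteq> {}"
    and lower: "\<And>a s. (a, s) \<in> K \<Longrightarrow> m \<le> (norm a)\<^sup>2 - s"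
  shows "\<exists>c. \<forall>(a, s)\<in>K. m + (norm (c - a))\<^sup>2 \<le> (norm a)\<^sup>2 - s"
proof -
  define g :: "'a \<times> real \<Rightarrow> real" where "g = (\<lambda>(a, s). (norm a)\<^sup>2 - s)"
  define M where "M = Inf (g ` K)"
  have bdd: "bdd_below (g ` K)"
    using lower by (intro bdd_belowI2 [where m = m]) (auto simp: g_def)
  have M_le: "M \<le> g k" if "k \<in> K" for k
    unfolding M_def using bdd that by (intro cINF_lower)
  have m_le: "m \<le> M"
    unfolding M_def using lower \<open>K \<noteq> {}\<close> by (intro cINF_greatest) (auto simp: g_def)
  have segment: "g ((1 - t) *\<^sub>R k + t *\<^sub>R l)
      = (1 - t) * g k + t * g l - t * (1 - t) * (norm (fst k - fst l))\<^sup>2" for t k l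
    by (cases k; cases l)
      (simp add: g_def power2_norm_eq_inner inner_add inner_diff inner_commute algebra_simps)
  have in_K: "(1 - t) *\<^sub>R k + t *\<^sub>R l \<in> K" if "k \<in> K" "l \<in> K" "0 \<le> t" "t \<le> 1" for t k l
    using \<open>convex K\<close> that by (auto simp: convex_alt)
  have "\<exists>k\<in>K. g k < M + 1 / real (Suc n)" for n
  proof -
    have "\<exists>r\<in>g ` K. r < M + 1 / real (Suc n)"
      unfolding M_def using \<open>K \<noteq> {}\<close> bdd by (subst cInf_less_iff [symmetric]) auto
    then show ?thesis by auto
  qed
  then obtain k where k: "\<And>n. k n \<in> K" "\<And>n. g (k n) < M + 1 / real (Suc n)"
    by metis
  have g_lim: "(\<lambda>n. g (k n)) \<longlonglongrightarrow> M"
  proof (rule tendsto_sandwich)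
    show "(\<lambda>n. M) \<longlonglongrightarrow> M" by simp
    show "(\<lambda>n. M + 1 / real (Suc n)) \<longlonglongrightarrow> M"
      using tendsto_add [OF tendsto_const LIMSEQ_inverse_real_of_nat, of M]
      by (simp add: inverse_eq_divide)
  qed (use k M_le in \<open>auto intro!: always_eventually less_imp_le\<close>)
  \<comment> \<open>The midpoint of two near-minimizers is again in \<open>K\<close>; comparing its value with \<open>M\<close> bounds their
      distance.\<close>
  have "Cauchy (\<lambda>n. fst (k n))"
  proof (rule metric_CauchyI)
    fix e :: real
    assume "e > 0"
    then obtain N where N: "\<And>n. n \<ge> N \<Longrightarrow> g (k n) < M + e\<^sup>2 / 4"
      using order_tendstoD(2) [OF g_lim, of "M + e\<^sup>2 / 4"] by (auto simp: eventually_sequentially)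
    have "dist (fst (k i)) (fst (k j)) < e" if "i \<ge> N" "j \<ge> N" for i j
    proof -
      have "M \<le> g ((1 - 1/2) *\<^sub>R k i + (1/2) *\<^sub>R k j)"
        using k in_K [of "k i" "k j" "1/2"] by (intro M_le) auto
      also have "\<dots> = (g (k i) + g (k j)) / 2 - (norm (fst (k i) - fst (k j)))\<^sup>2 / 4"
        by (subst segment) (simp add: field_simps)
      finally have "(norm (fst (k i) - fst (k j)))\<^sup>2 < e\<^sup>2"
        using N [OF that(1)] N [OF that(2)] by (simp add: field_simps)
      then show ?thesis
        using \<open>e > 0\<close> by (simp add: dist_norm power2_less_imp_less)
    qed
    then show "\<exists>N. \<forall>i\<ge>N. \<forall>j\<ge>N. dist (fst (k i)) (fst (k j)) < e" by blast
  qed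
  then obtain c where c: "(\<lambda>n. fst (k n)) \<longlonglongrightarrow> c"
    using Cauchy_convergent_iff convergent_def by blast
  have "m + (norm (c - a))\<^sup>2 \<le> (norm a)\<^sup>2 - s" if "(a, s) \<in> K" for a s
  proof -
    \<comment> \<open>Move from \<open>k n\<close> a fraction \<open>t\<close> towards \<open>(a, s)\<close>, let \<open>n\<close> tend to infinity, divide by \<open>t\<close>; the
        loss \<open>1 - t\<close> disappears as \<open>t\<close> tends to \<open>0\<close>.\<close>
    have step: "M + (1 - t) * (norm (c - a))\<^sup>2 \<le> g (a, s)" if t: "0 < t" "t \<le> 1" for t
    proof -
      have ge: "M \<le> (1 - t) * g (k n) + t * g (a, s) - t * (1 - t) * (norm (fst (k n) - a))\<^sup>2" for n
        using M_le [OF in_K [OF k(1) \<open>(a, s) \<in> K\<close>, of t n]] t segment [of t "k n" "(a, s)"]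
        by (simp del: scaleR_Pair)
      have "(\<lambda>n. (1 - t) * g (k n) + t * g (a, s) - t * (1 - t) * (norm (fst (k n) - a))\<^sup>2)
          \<longlonglongrightarrow> (1 - t) * M + t * g (a, s) - t * (1 - t) * (norm (c - a))\<^sup>2"
        by (intro tendsto_intros g_lim c)
      then have "M \<le> (1 - t) * M + t * g (a, s) - t * (1 - t) * (norm (c - a))\<^sup>2"
        by (rule LIMSEQ_le_const) (use ge in blast)
      then have "t * (M + (1 - t) * (norm (c - a))\<^sup>2) \<le> t * g (a, s)"
        by (simp add: algebra_simps)
      then show ?thesis
        using t by (simp only: mult_le_cancel_left_pos)
    qed
    have "((\<lambda>t. M + (1 - t) * (norm (c - a))\<^sup>2) \<longlongrightarrow> M + (1 - 0) * (norm (c - a))\<^sup>2) (at_right 0)"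
      by (intro tendsto_intros)
    moreover have "\<forall>\<^sub>F t in at_right 0. M + (1 - t) * (norm (c - a))\<^sup>2 \<le> g (a, s)"
      using eventually_at_right_less [of 0] eventually_at_right_field [of "\<lambda>t. t \<le> 1" "0::real"]
      by (intro eventually_at_rightI [of 0 1]) (auto intro!: step)
    ultimately have "M + (1 - 0) * (norm (c - a))\<^sup>2 \<le> g (a, s)"
      by (rule tendsto_upperbound) simp
    then show ?thesis using m_le by (simp add: g_def)
  qed
  then show ?thesis by blast
qed

text \<open>
  Minimize \<open>\<parallel>v\<parallel>\<^sup>2 - 2 f v\<close>, which is bounded below because \<open>f\<close> is bounded. The quadratic terms in the
  optimality condition cancel, so that the linear functional \<open>f - \<langle>c, -\<rangle>\<close> is bounded above and
  hence zero.
\<close>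
lemma riesz_representation:
  fixes f :: "'a::{real_inner, complete_space} \<Rightarrow> real"
  assumes "bounded_linear f"
  shows "\<exists>c. \<forall>v. f v = inner c v"
proof -
  interpret f: bounded_linear f by fact
  obtain L where L: "\<And>v. norm (f v) \<le> norm v * L"
    using f.bounded by blast
  define K where "K = range (\<lambda>v. (v, 2 * f v))"
  have "linear (\<lambda>v. (v, 2 * f v))"
    by (intro linearI) (auto simp: f.add f.scaleR algebra_simps)
  then have "convex K"
    unfolding K_def by (intro convex_linear_image convex_UNIV)
  moreover have "- L\<^sup>2 \<le> (norm a)\<^sup>2 - s" if "(a, s) \<in> K" for a s
  proof -
    have "s \<le> 2 * (norm a * L)"
      using that L [of a] by (auto simp: K_def)
    moreover have "0 \<le> (norm a - L)\<^sup>2" by simp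
    ultimately show ?thesis by (simp add: power2_diff)
  qed
  ultimately obtain c where c: "\<And>v. - L\<^sup>2 + (norm (c - v))\<^sup>2 \<le> (norm v)\<^sup>2 - 2 * f v"
    using strong_convexity_minimum [of K "- L\<^sup>2"] by (auto simp: K_def)
  define h where "h v = f v - inner c v" for v
  have h_le: "2 * h v \<le> L\<^sup>2 - (norm c)\<^sup>2" for v
    using c [of v] by (simp add: h_def power2_norm_eq_inner inner_diff inner_commute)
  have "h v = 0" for v
  proof (rule ccontr)
    assume "h v \<noteq> 0"
    define r where "r = (L\<^sup>2 - (norm c)\<^sup>2 + 1) / (2 * h v)"
    have "h (r *\<^sub>R v) = r * h v"
      by (simp add: h_def f.scaleR algebra_simps)
    then have "2 * h (r *\<^sub>R v) = L\<^sup>2 - (norm c)\<^sup>2 + 1"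
      using \<open>h v \<noteq> 0\<close> by (simp add: r_def)
    then show False using h_le [of "r *\<^sub>R v"] by simp
  qed
  then show ?thesis by (auto simp: h_def)
qed

section \<open>Minty's theorem and resolvents\<close>

lemma monotone_operatorD:
  assumes "monotone_operator A" "u \<in> A x" "v \<in> A y"
  shows "0 \<le> inner (x - y) (u - v)"
  using assms by (fastforce simp: monotone_operator_def gra_def)

text \<open>
  Otherwise the point \<open>(x, u)\<close> could be added to the graph. All memberships in the graph of a
  maximally monotone operator are established through this test.
\<close>
lemma maximally_monotoneD:
  assumes "maximally_monotone A" "\<And>y v. v \<in> A y \<Longrightarrow> 0 \<le> inner (x - y) (u - v)"
  shows "u \<in> A x"
proof (rule ccontr)
  assume "u \<notin> A x"
  define C where "C = A(x := insert u (A x))"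
  have mono: "monotone_operator A"
    using assms(1) by (simp add: maximally_monotone_def)
  have C_cases: "q \<in> A p \<or> p = x \<and> q = u" if "q \<in> C p" for p q
    using that by (auto simp: C_def split: if_splits)
  have "0 \<le> inner (p - p') (q - q')" if "q \<in> C p" "q' \<in> C p'" for p q p' q'
  proof -
    have "inner (p - x) (q - u) = inner (x - p) (u - q)" for p q
      by (metis inner_minus_left inner_minus_right minus_diff_eq minus_minus)
    then show ?thesis
      using C_cases [OF that(1)] C_cases [OF that(2)] monotone_operatorD [OF mono] assms(2)
      by auto
  qed
  then have "monotone_operator C"
    unfolding monotone_operator_def gra_def by blast
  moreover have "gra A \<subset> gra C"
  proof
    show "gra A \<subseteq> gra C" by (auto simp: gra_def C_def)
    have "(x, u) \<in> gra C" "(x, u) \<notin> gra A"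
      using \<open>u \<notin> A x\<close> by (simp_all add: gra_def C_def)
    then show "gra A \<noteq> gra C" by blast
  qed
  ultimately show False
    using assms(1) unfolding maximally_monotone_def by blast
qed

text \<open>
  By maximality it suffices to find \<open>c\<close> with \<open>\<langle>c - y, c - v\<rangle> \<le> 0\<close> whenever \<open>w - v \<in> A y\<close>, that is, a
  common point of the balls with diameters \<open>[y, v]\<close>. With \<open>a\<close> the midpoint of \<open>y\<close> and \<open>v\<close> and
  \<open>s = \<langle>y, v\<rangle>\<close>, this reads \<open>\<parallel>c - a\<parallel>\<^sup>2 \<le> \<parallel>a\<parallel>\<^sup>2 - s\<close>, which is what \<open>strong_convexity_minimum\<close> gives with
  \<open>m = 0\<close>, once \<open>s \<le> \<parallel>a\<parallel>\<^sup>2\<close> is known on the convex hull of all pairs \<open>(a, s)\<close>. That bound is where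
  monotonicity enters: on the hull of the triples \<open>(y, v, \<langle>y, v\<rangle>)\<close> one has \<open>s \<le> \<langle>y, v\<rangle>\<close>.
\<close>
theorem minty:
  fixes A :: "'a::{real_inner, complete_space} \<Rightarrow> 'a set"
  assumes A: "maximally_monotone A"
  shows "\<exists>p. w - p \<in> A p"
proof -
  have mono: "monotone_operator A"
    using A by (simp add: maximally_monotone_def)
  define G :: "('a \<times> 'a \<times> real) set" where "G = {(y, v, inner y v) | y v. w - v \<in> A y}"
  have in_G: "(y, w - u, inner y (w - u)) \<in> G" if "u \<in> A y" for y u
    using that by (simp add: G_def)
  define H where "H = convex hull G"
  \<comment> \<open>For triples of \<open>G\<close>, \<open>q\<close> is \<open>- \<langle>y - y', v - v'\<rangle>\<close>, nonnegative by monotonicity. It is affine in each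
      argument, so nonnegativity passes to the hull one argument at a time, and on the diagonal
      it says \<open>s \<le> \<langle>y, v\<rangle>\<close>.\<close>
  define q :: "'a \<times> 'a \<times> real \<Rightarrow> 'a \<times> 'a \<times> real \<Rightarrow> real" where
    "q = (\<lambda>(y, v, s) (y', v', s'). inner y v' + inner y' v - s - s')"
  have q_sym: "q k l = q l k" for k l
    by (cases k; cases l) (simp add: q_def)
  have halfspace: "convex {l. 0 \<le> q k l}" for k
  proof (rule convexI)
    have q_comb: "q k (u *\<^sub>R l + v *\<^sub>R l') = u * q k l + v * q k l'"
      if "u + v = 1" for u v l l'
    proof -
      obtain y w s where k: "k = (y, w, s)" by (cases k)
      have v: "v = 1 - u" using that by simp
      show ?thesis
        unfolding v k by (cases l; cases l') (simp add: q_def inner_add algebra_simps)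
    qed
    show "u *\<^sub>R l + v *\<^sub>R l' \<in> {l. 0 \<le> q k l}"
      if "l \<in> {l. 0 \<le> q k l}" "l' \<in> {l. 0 \<le> q k l}" "0 \<le> u" "0 \<le> v" "u + v = 1" for l l' u v
      using that by (simp add: q_comb)
  qed
  have "0 \<le> q k l" if kl: "k \<in> G" "l \<in> G" for k l
  proof -
    obtain y v y' v' where
      *: "k = (y, v, inner y v)" "l = (y', v', inner y' v')" "w - v \<in> A y" "w - v' \<in> A y'"
      using kl unfolding G_def by blast
    have "0 \<le> inner (y - y') (v' - v)"
      using monotone_operatorD [OF mono *(3,4)] by simp
    then show ?thesis by (simp add: * q_def inner_diff)
  qed
  then have "H \<subseteq> {l. 0 \<le> q k l}" if "k \<in> G" for k
    unfolding H_def using that by (intro hull_minimal halfspace) blast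
  then have "G \<subseteq> {l. 0 \<le> q k l}" if "k \<in> H" for k
    using that q_sym [of k] by auto
  then have "H \<subseteq> {l. 0 \<le> q k l}" if "k \<in> H" for k
    using that unfolding H_def by (intro hull_minimal halfspace)
  then have "0 \<le> q k k" if "k \<in> H" for k
    using that by blast
  then have H_le: "s \<le> inner y v" if "(y, v, s) \<in> H" for y v s
    using that by (fastforce simp: q_def)
  define mid :: "'a \<times> 'a \<times> real \<Rightarrow> 'a \<times> real" where "mid = (\<lambda>(y, v, s). ((1/2) *\<^sub>R (y + v), s))"
  have "linear mid"
    by (rule linearI) (auto simp: mid_def algebra_simps)
  then have "convex (mid ` H)"
    by (simp add: H_def convex_linear_image)
  moreover have "mid ` H \<noteq> {}"
  proof -
    have "G \<noteq> {}"
    proof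
      assume "G = {}"
      then have "u \<notin> A y" for u y
        using in_G by blast
      then show False using maximally_monotoneD [OF A] by blast
    qed
    then show ?thesis by (simp add: H_def)
  qed
  moreover have "0 \<le> (norm a)\<^sup>2 - s" if as: "(a, s) \<in> mid ` H" for a s
  proof -
    obtain y v where a: "a = (1/2) *\<^sub>R (y + v)" and "(y, v, s) \<in> H"
      using as by (auto simp: mid_def)
    have "(norm a)\<^sup>2 = inner y v + (norm ((1/2) *\<^sub>R (y - v)))\<^sup>2"
      by (simp add: a power2_norm_eq_inner inner_add inner_diff inner_commute field_simps)
    then show ?thesis
      using H_le [OF \<open>(y, v, s) \<in> H\<close>] zero_le_power2 [of "norm ((1/2) *\<^sub>R (y - v))"]
      by linarith
  qed
  ultimately obtain c where
    c: "\<And>a s. (a, s) \<in> mid ` H \<Longrightarrow> (norm (c - a))\<^sup>2 \<le> (norm a)\<^sup>2 - s"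
    using strong_convexity_minimum [of "mid ` H" 0] by fastforce
  have "0 \<le> inner (c - y) (w - c - u)" if "u \<in> A y" for y u
  proof -
    have "(y, w - u, inner y (w - u)) \<in> H"
      unfolding H_def using that by (intro hull_inc in_G)
    then have "((1/2) *\<^sub>R (y + (w - u)), inner y (w - u)) \<in> mid ` H"
      by (force simp: mid_def)
    from c [OF this] have "(norm c)\<^sup>2 - inner c (y + (w - u)) + inner y (w - u) \<le> 0"
      by (simp add: power2_norm_eq_inner inner_add inner_diff inner_commute field_simps)
    then show ?thesis
      by (simp add: power2_norm_eq_inner inner_add inner_diff inner_commute algebra_simps)
  qed
  then show ?thesis
    using maximally_monotoneD [OF A, of c "w - c"] by blast
qed

lemma maximally_monotone_scale:
  assumes A: "maximally_monotone A" and "\<gamma> > 0"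
  shows "maximally_monotone (op_scale \<gamma> A)"
proof -
  have mem_scale: "u \<in> op_scale r C x \<longleftrightarrow> (1 / r) *\<^sub>R u \<in> C x" if "r > 0"
    for r u x and C :: "'a \<Rightarrow> 'a set"
    using that by (force simp: op_scale_def)
  have mono: "monotone_operator (op_scale r C)" if "r > 0" "monotone_operator C"
    for r and C :: "'a \<Rightarrow> 'a set"
    unfolding monotone_operator_def gra_def
  proof clarsimp
    fix x u y v
    assume "u \<in> op_scale r C x" "v \<in> op_scale r C y"
    then have "0 \<le> inner (x - y) ((1 / r) *\<^sub>R u - (1 / r) *\<^sub>R v)"
      using that by (intro monotone_operatorD) (auto simp: mem_scale)
    then have "0 \<le> (1 / r) * inner (x - y) (u - v)"
      by (simp add: inner_diff right_diff_distrib)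
    then show "0 \<le> inner (x - y) (u - v)"
      using \<open>r > 0\<close> by (simp add: zero_le_divide_iff)
  qed
  have "\<not> gra (op_scale \<gamma> A) \<subset> gra C" if "monotone_operator C" for C
  proof
    assume less: "gra (op_scale \<gamma> A) \<subset> gra C"
    have "u \<in> op_scale \<gamma> A x" if "u \<in> C x" for u x
    proof -
      have "(1 / \<gamma>) *\<^sub>R u \<in> A x"
      proof (rule maximally_monotoneD [OF A])
        fix y v
        assume "v \<in> A y"
        then have "\<gamma> *\<^sub>R v \<in> C y"
          using less by (auto simp: gra_def op_scale_def)
        then have "0 \<le> inner (x - y) (u - \<gamma> *\<^sub>R v)"
          by (intro monotone_operatorD [OF \<open>monotone_operator C\<close> that])
        also have "\<dots> = \<gamma> * inner (x - y) ((1 / \<gamma>) *\<^sub>R u - v)"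
          using \<open>\<gamma> > 0\<close> by (simp add: inner_diff field_simps)
        finally show "0 \<le> inner (x - y) ((1 / \<gamma>) *\<^sub>R u - v)"
          using \<open>\<gamma> > 0\<close> by (simp add: zero_le_mult_iff)
      qed
      then show ?thesis using mem_scale \<open>\<gamma> > 0\<close> by blast
    qed
    then show False using less by (auto simp: gra_def)
  qed
  then show ?thesis
    using mono A \<open>\<gamma> > 0\<close> by (auto simp: maximally_monotone_def)
qed

lemma resolvent_eq_iff:
  fixes A :: "'a::{real_inner, complete_space} \<Rightarrow> 'a set"
  assumes A: "maximally_monotone A"
  shows "resolvent A x = p \<longleftrightarrow> x - p \<in> A p"
proof -
  have mono: "monotone_operator A"
    using A by (simp add: maximally_monotone_def)
  have unique: "p = q" if "x - p \<in> A p" "x - q \<in> A q" for p q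
  proof -
    have "0 \<le> inner (p - q) (q - p)"
      using monotone_operatorD [OF mono that] by simp
    also have "\<dots> = - inner (p - q) (p - q)"
      by (simp add: inner_diff)
    finally have "inner (p - q) (p - q) \<le> 0" by simp
    then show ?thesis by (metis inner_ge_zero inner_eq_zero_iff order_antisym right_minus_eq)
  qed
  have inverse: "op_inverse (op_plus op_id A) x = {p. x - p \<in> A p}"
    by (force simp: op_inverse_def op_plus_def op_id_def)
  obtain r where r: "x - r \<in> A r"
    using minty [OF A] by blast
  then have "op_inverse (op_plus op_id A) x = {r}"
    using unique by (auto simp: inverse)
  then have "resolvent A x = r" by (simp add: resolvent_def)
  then show ?thesis using unique r by auto
qed

lemma resolvent_in:
  fixes A :: "'a::{real_inner, complete_space} \<Rightarrow> 'a set"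
  assumes "maximally_monotone A"
  shows "x - resolvent A x \<in> A (resolvent A x)"
  using resolvent_eq_iff [OF assms] by blast

lemma resolvent_firmly_nonexpansive:
  fixes A :: "'a::{real_inner, complete_space} \<Rightarrow> 'a set"
  assumes A: "maximally_monotone A"
  shows "(norm (resolvent A x - resolvent A y))\<^sup>2 \<le> inner (resolvent A x - resolvent A y) (x - y)"
proof -
  let ?p = "resolvent A x" and ?q = "resolvent A y"
  have "0 \<le> inner (?p - ?q) ((x - ?p) - (y - ?q))"
    using A by (intro monotone_operatorD [of A] resolvent_in) (auto simp: maximally_monotone_def)
  also have "(x - ?p) - (y - ?q) = (x - y) - (?p - ?q)" by simp
  finally show ?thesis by (simp add: inner_diff_right power2_norm_eq_inner)
qed

lemma resolvent_nonexpansive: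
  fixes A :: "'a::{real_inner, complete_space} \<Rightarrow> 'a set"
  assumes A: "maximally_monotone A"
  shows "norm (resolvent A x - resolvent A y) \<le> norm (x - y)"
proof -
  let ?d = "resolvent A x - resolvent A y"
  have "norm ?d * norm ?d \<le> norm ?d * norm (x - y)"
    using resolvent_firmly_nonexpansive [OF A, of x y] norm_cauchy_schwarz [of ?d "x - y"]
    by (simp add: power2_eq_square)
  then show ?thesis
    by (metis mult_le_cancel_left_pos norm_ge_zero order_le_less)
qed

lemma reflector_nonexpansive:
  fixes A :: "'a::{real_inner, complete_space} \<Rightarrow> 'a set"
  assumes A: "maximally_monotone A"
  shows "norm (reflector A x - reflector A y) \<le> norm (x - y)"
proof -
  let ?d = "resolvent A x - resolvent A y"
  have "reflector A x - reflector A y = 2 *\<^sub>R ?d - (x - y)"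
    by (simp add: reflector_def algebra_simps)
  moreover have "(norm (2 *\<^sub>R ?d - (x - y)))\<^sup>2
      = (norm (x - y))\<^sup>2 - 4 * (inner ?d (x - y) - (norm ?d)\<^sup>2)"
    unfolding power2_norm_eq_inner inner_diff_left [of "2 *\<^sub>R ?d"] inner_diff_right [of _ "2 *\<^sub>R ?d"]
    by (simp add: inner_commute)
  ultimately have "(norm (reflector A x - reflector A y))\<^sup>2 \<le> (norm (x - y))\<^sup>2"
    using resolvent_firmly_nonexpansive [OF A, of x y] by simp
  then show ?thesis by (rule power2_le_imp_le) simp
qed

section \<open>Weak convergence along filters\<close>

text \<open>
  Filters other than \<open>sequentially\<close> are needed because cluster points are obtained from Tychonoff's
  theorem, which yields finer filters rather than subsequences; this avoids separability and
  diagonal arguments.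
\<close>
definition weakly_tendsto :: "('i \<Rightarrow> 'a::real_inner) \<Rightarrow> 'a \<Rightarrow> 'i filter \<Rightarrow> bool" where
  "weakly_tendsto X l F \<longleftrightarrow> (\<forall>u. ((\<lambda>i. inner (X i) u) \<longlongrightarrow> inner l u) F)"

lemma weakly_tendstoD:
  assumes "weakly_tendsto X l F"
  shows "((\<lambda>i. inner (X i) u) \<longlongrightarrow> inner l u) F" "((\<lambda>i. inner u (X i)) \<longlongrightarrow> inner u l) F"
  using assms by (auto simp: weakly_tendsto_def inner_commute)

lemma weakly_tendsto_mono: "weakly_tendsto X l F \<Longrightarrow> G \<le> F \<Longrightarrow> weakly_tendsto X l G"
  by (auto simp: weakly_tendsto_def intro: tendsto_mono)

lemma weakly_tendsto_diff:
  "weakly_tendsto X l F \<Longrightarrow> weakly_tendsto Y m F \<Longrightarrow> weakly_tendsto (\<lambda>i. X i - Y i) (l - m) F"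
  by (auto simp: weakly_tendsto_def inner_diff_left intro!: tendsto_diff)

lemma weakly_tendsto_perturb:
  assumes "weakly_tendsto X l F" "((\<lambda>i. Y i - X i) \<longlongrightarrow> 0) F"
  shows "weakly_tendsto Y l F"
  unfolding weakly_tendsto_def
proof
  fix u
  have "((\<lambda>i. inner (X i) u + inner (Y i - X i) u) \<longlongrightarrow> inner l u + inner 0 u) F"
    by (intro tendsto_intros assms weakly_tendstoD)
  then show "((\<lambda>i. inner (Y i) u) \<longlongrightarrow> inner l u) F"
    by (simp add: inner_diff_left)
qed

text \<open>
  A bounded family, viewed as functionals \<open>u \<mapsto> \<langle>X i, u\<rangle>\<close>, lives in a product of compact intervals, so
  it has a pointwise cluster point. Pointwise limits of functionals with a common bound are
  linear and bounded, hence represented by a vector.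
\<close>
lemma weak_cluster_point:
  fixes X :: "'i \<Rightarrow> 'a::{real_inner, complete_space}"
  assumes "F \<noteq> bot" and bound: "\<And>i. norm (X i) \<le> C"
  shows "\<exists>G x. G \<le> F \<and> G \<noteq> bot \<and> weakly_tendsto X x G"
proof -
  define \<phi> where "\<phi> i = (\<lambda>u. inner (X i) u)" for i
  define U :: "('a \<Rightarrow> real) set" where "U = PiE UNIV (\<lambda>u. {- (C * norm u)..C * norm u})"
  have "compactin (product_topology (\<lambda>u. euclidean) UNIV) U"
    unfolding U_def compactin_PiE by simp
  then have "compact U"
    by (simp add: euclidean_product_topology)
  moreover have inner_le: "\<bar>inner (X i) u\<bar> \<le> C * norm u" for i u
    using Cauchy_Schwarz_ineq2 [of "X i" u] mult_right_mono [OF bound [of i], of "norm u"] by simp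
  then have "\<phi> i \<in> U" for i
    by (auto simp: U_def \<phi>_def abs_le_iff minus_le_iff)
  ultimately obtain f where "f \<in> U" and f: "inf (nhds f) (filtermap \<phi> F) \<noteq> bot"
    using \<open>F \<noteq> bot\<close> unfolding compact_filter
    by (metis always_eventually eventually_filtermap filtermap_bot_iff)
  define G where "G = inf F (filtercomap \<phi> (nhds f))"
  have "G \<noteq> bot"
  proof
    assume "G = bot"
    then obtain P Q where P: "eventually P F" and Q: "eventually Q (nhds f)"
        and "\<And>i. P i \<Longrightarrow> \<not> Q (\<phi> i)"
      by (auto simp: G_def trivial_limit_def eventually_inf eventually_filtercomap)
    then have "eventually (\<lambda>h. \<not> Q h) (filtermap \<phi> F)"
      by (auto simp: eventually_filtermap elim: eventually_mono)
    then have "eventually (\<lambda>h. False) (inf (nhds f) (filtermap \<phi> F))"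
      using Q by (auto simp: eventually_inf)
    then show False using f by (simp add: eventually_False)
  qed
  have lim: "((\<lambda>i. inner (X i) u) \<longlongrightarrow> f u) G" for u
  proof -
    have \<phi>_lim: "(\<phi> \<longlongrightarrow> f) G"
      unfolding G_def filterlim_def
      by (meson filtermap_filtercomap filtermap_mono inf_le2 order_trans)
    show ?thesis
    proof (rule topological_tendstoI)
      fix S
      assume "open S" "f u \<in> S"
      then have "open {h. h u \<in> S}" "f \<in> {h. h u \<in> S}"
        using product_topology_basis' [of "{u}" "\<lambda>_. S" "\<lambda>v. v"] by simp_all
      then have "\<forall>\<^sub>F i in G. \<phi> i \<in> {h. h u \<in> S}"
        by (rule topological_tendstoD [OF \<phi>_lim])
      then show "\<forall>\<^sub>F i in G. inner (X i) u \<in> S"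
        by (simp add: \<phi>_def)
    qed
  qed
  have "bounded_linear f"
  proof (rule bounded_linear_intro)
    show "f (u + v) = f u + f v" for u v
      using tendsto_add [OF lim lim, of u v] lim [of "u + v"] \<open>G \<noteq> bot\<close>
      by (auto simp: inner_add_right intro: tendsto_unique)
    show "f (r *\<^sub>R u) = r *\<^sub>R f u" for r u
      using tendsto_mult_left [OF lim, of r u] lim [of "r *\<^sub>R u"] \<open>G \<noteq> bot\<close>
      by (auto intro: tendsto_unique)
    show "norm (f u) \<le> norm u * C" for u
      using \<open>f \<in> U\<close> by (auto simp: U_def PiE_iff abs_le_iff mult.commute minus_le_iff)
  qed
  then obtain x where "\<And>v. f v = inner x v"
    using riesz_representation by blast
  then have "weakly_tendsto X x G"
    using lim by (simp add: weakly_tendsto_def)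
  moreover have "G \<le> F" by (simp add: G_def)
  ultimately show ?thesis using \<open>G \<noteq> bot\<close> by blast
qed

text \<open>
  If the convergence failed for some functional and neighbourhood, a cluster point of the
  restriction to the indices outside that neighbourhood would be a second one.
\<close>
lemma weakly_tendsto_if_unique_cluster_point:
  fixes X :: "'i \<Rightarrow> 'a::{real_inner, complete_space}"
  assumes bound: "\<And>i. norm (X i) \<le> C"
    and unique: "\<And>G y. G \<le> F \<Longrightarrow> G \<noteq> bot \<Longrightarrow> weakly_tendsto X y G \<Longrightarrow> y = x"
  shows "weakly_tendsto X x F"
  unfolding weakly_tendsto_def
proof (intro allI topological_tendstoI, rule ccontr)
  fix u S
  assume S: "open S" "inner x u \<in> S" and neg: "\<not> (\<forall>\<^sub>F i in F. inner (X i) u \<in> S)"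
  define F' where "F' = inf F (principal {i. inner (X i) u \<notin> S})"
  have "F' \<noteq> bot"
    using neg by (simp add: F'_def trivial_limit_def eventually_inf_principal)
  then obtain G y where G: "G \<le> F'" "G \<noteq> bot" "weakly_tendsto X y G"
    using weak_cluster_point bound by blast
  then have "y = x"
    using unique [of G y] by (simp add: F'_def)
  then have "((\<lambda>i. inner (X i) u) \<longlongrightarrow> inner x u) G"
    using weakly_tendstoD(1) [OF G(3)] by simp
  then have "\<forall>\<^sub>F i in G. inner (X i) u \<in> S"
    using S by (rule topological_tendstoD)
  moreover have "\<forall>\<^sub>F i in G. inner (X i) u \<notin> S"
    using G(1) by (simp add: F'_def le_principal)
  ultimately have "\<forall>\<^sub>F i in G. False"
    by eventually_elim simp
  then show False using G(2) by (simp add: eventually_False)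
qed

lemma tendsto_inner_bounded_null:
  fixes X e :: "'i \<Rightarrow> 'a::real_inner"
  assumes "\<And>i. norm (X i) \<le> C" "(e \<longlongrightarrow> 0) F"
  shows "((\<lambda>i. inner (X i) (e i)) \<longlongrightarrow> 0) F" "((\<lambda>i. inner (e i) (X i)) \<longlongrightarrow> 0) F"
proof -
  have lim: "((\<lambda>i. C * norm (e i)) \<longlongrightarrow> 0) F"
    using assms(2) by (auto intro!: tendsto_mult_right_zero tendsto_norm_zero)
  have "norm (inner (X i) (e i)) \<le> C * norm (e i)" for i
    using Cauchy_Schwarz_ineq2 [of "X i" "e i"] mult_right_mono [OF assms(1) [of i], of "norm (e i)"]
    by simp
  then show "((\<lambda>i. inner (X i) (e i)) \<longlongrightarrow> 0) F"
    by (intro Lim_null_comparison [OF always_eventually lim]) blast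
  then show "((\<lambda>i. inner (e i) (X i)) \<longlongrightarrow> 0) F"
    by (simp add: inner_commute)
qed

text \<open>
  The inner product is not jointly weakly continuous, so a single inequality
  \<open>0 \<le> \<langle>p i - s, v i - u\<rangle>\<close> does not pass to the limit. Because \<open>q i \<approx> p i\<close> and \<open>w i \<approx> - v i\<close>, the
  offending term \<open>\<langle>p i, v i\<rangle>\<close> cancels in the sum of the inequalities for \<open>A\<close> and \<open>B\<close>.
\<close>
lemma weak_limit_in_both_graphs:
  fixes A B :: "'a::{real_inner, complete_space} \<Rightarrow> 'a set"
  assumes A: "maximally_monotone A" and B: "maximally_monotone B"
    and "F \<noteq> bot"
    and v_in: "\<And>i. v i \<in> B (p i)" and w_in: "\<And>i. w i \<in> A (q i)"
    and p_lim: "weakly_tendsto p p' F" and v_lim: "weakly_tendsto v v' F"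
    and p_bound: "\<And>i. norm (p i) \<le> C" and v_bound: "\<And>i. norm (v i) \<le> D"
    and qp: "((\<lambda>i. q i - p i) \<longlongrightarrow> 0) F" and vw: "((\<lambda>i. v i + w i) \<longlongrightarrow> 0) F"
  shows "v' \<in> B p'" "- v' \<in> A p'"
proof -
  have limit_ineq: "0 \<le> inner (p' - s) (v' - u) + inner (p' - t) (- v' - r)"
    if "u \<in> B s" "r \<in> A t" for s u t r
  proof (rule tendsto_lowerbound [OF _ always_eventually \<open>F \<noteq> bot\<close>])
    let ?E = "\<lambda>i. inner (p i - s) (v i - u) + inner (q i - t) (w i - r)"
    have "?E = (\<lambda>i. inner s u + inner t r - inner (p i) u - inner (p i) r - inner s (v i) + inner t (v i)
        + inner (p i) (v i + w i) - inner t (v i + w i)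
        + (inner (q i - p i) (v i + w i) - inner (q i - p i) (v i) - inner (q i - p i) r))"
      by (simp add: inner_diff inner_add inner_commute algebra_simps)
    moreover have "(\<dots> \<longlongrightarrow> inner s u + inner t r - inner p' u - inner p' r - inner s v' + inner t v'
        + 0 - inner t 0 + (inner 0 (0 :: 'a) - 0 - inner 0 r)) F"
      by (intro tendsto_add tendsto_diff tendsto_const weakly_tendstoD [OF p_lim]
          weakly_tendstoD [OF v_lim] tendsto_inner_bounded_null(1) [OF p_bound vw]
          tendsto_inner_bounded_null(2) [OF v_bound qp] tendsto_inner [OF tendsto_const vw]
          tendsto_inner [OF qp vw] tendsto_inner [OF qp tendsto_const])
    ultimately show "(?E \<longlongrightarrow> inner (p' - s) (v' - u) + inner (p' - t) (- v' - r)) F"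
      by (simp add: inner_diff inner_add inner_commute algebra_simps)
    show "\<forall>i. 0 \<le> ?E i"
      using A B that v_in w_in
      by (intro allI add_nonneg_nonneg monotone_operatorD) (auto simp: maximally_monotone_def)
  qed
  \<comment> \<open>With these test points both inner products become negative squares, so both vanish.\<close>
  define s where "s = resolvent B (p' + v')"
  define t where "t = resolvent A (p' - v')"
  have s: "p' + v' - s \<in> B s" and t: "p' - v' - t \<in> A t"
    using resolvent_in A B by (auto simp: s_def t_def)
  have "0 \<le> inner (p' - s) (s - p') + inner (p' - t) (t - p')"
    using limit_ineq [OF s t] by (simp add: algebra_simps)
  also have "\<dots> = - ((norm (p' - s))\<^sup>2 + (norm (p' - t))\<^sup>2)"
    by (simp add: power2_norm_eq_inner inner_diff inner_commute)
  finally have "(norm (p' - s))\<^sup>2 + (norm (p' - t))\<^sup>2 = 0"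
    using zero_le_power2 [of "norm (p' - s)"] zero_le_power2 [of "norm (p' - t)"] by linarith
  then have "p' = s" "p' = t"
    by (auto simp: sum_power2_eq_zero_iff)
  then show "v' \<in> B p'" "- v' \<in> A p'"
    using s t by simp_all
qed

text \<open>
  The convergent distances to two cluster points \<open>x\<close> and \<open>y\<close> determine \<open>lim \<langle>X n, x - y\<rangle>\<close>. Evaluated
  along either of the two filters, this limit is \<open>\<langle>x, x - y\<rangle>\<close> and \<open>\<langle>y, x - y\<rangle>\<close>, whence \<open>x = y\<close>.
\<close>
lemma opial:
  fixes X :: "nat \<Rightarrow> 'a::{real_inner, complete_space}"
  assumes bound: "\<And>n. norm (X n) \<le> C"
    and cluster: "\<And>G y. G \<le> sequentially \<Longrightarrow> G \<noteq> bot \<Longrightarrow> weakly_tendsto X y G \<Longrightarrow> y \<in> S"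
    and dist: "\<And>y. y \<in> S \<Longrightarrow> convergent (\<lambda>n. norm (X n - y))"
  shows "\<exists>x\<in>S. weakly_tendsto X x sequentially"
proof -
  obtain G x where G: "G \<le> sequentially" "G \<noteq> bot" "weakly_tendsto X x G"
    using weak_cluster_point [of sequentially X C] bound by auto
  then have "x \<in> S" using cluster by blast
  have "y = x" if H: "H \<le> sequentially" "H \<noteq> bot" "weakly_tendsto X y H" for H y
  proof -
    have "y \<in> S" using cluster H by blast
    obtain k l where "(\<lambda>n. norm (X n - x)) \<longlonglongrightarrow> k" "(\<lambda>n. norm (X n - y)) \<longlonglongrightarrow> l"
      using dist [OF \<open>x \<in> S\<close>] dist [OF \<open>y \<in> S\<close>] by (auto simp: convergent_def)
    then have "(\<lambda>n. ((norm (X n - y))\<^sup>2 - (norm (X n - x))\<^sup>2 + (norm x)\<^sup>2 - (norm y)\<^sup>2) / 2)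
        \<longlonglongrightarrow> (l\<^sup>2 - k\<^sup>2 + (norm x)\<^sup>2 - (norm y)\<^sup>2) / 2" (is "_ \<longlonglongrightarrow> ?L")
      by (intro tendsto_intros) auto
    moreover have "((norm (X n - y))\<^sup>2 - (norm (X n - x))\<^sup>2 + (norm x)\<^sup>2 - (norm y)\<^sup>2) / 2
        = inner (X n) (x - y)" for n
      by (simp add: power2_norm_eq_inner inner_diff inner_commute)
    ultimately have lim: "(\<lambda>n. inner (X n) (x - y)) \<longlonglongrightarrow> ?L"
      by simp
    have "inner x (x - y) = ?L"
      using tendsto_unique [OF G(2) weakly_tendstoD(1) [OF G(3)] tendsto_mono [OF G(1) lim]] .
    moreover have "inner y (x - y) = ?L"
      using tendsto_unique [OF H(2) weakly_tendstoD(1) [OF H(3)] tendsto_mono [OF H(1) lim]] .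
    ultimately have "inner (x - y) (x - y) = 0"
      by (simp only: inner_diff_left)
    then show ?thesis by simp
  qed
  then have "weakly_tendsto X x sequentially"
    using bound by (intro weakly_tendsto_if_unique_cluster_point)
  then show ?thesis using \<open>x \<in> S\<close> by blast
qed

section \<open>Mean iterations of nonexpansive maps\<close>

text \<open>
  The Silverman--Toeplitz argument: the columns tending to \<open>0\<close> make the first \<open>N\<close> terms of \<open>r\<close>
  negligible, and the weights of the others sum to at most \<open>1\<close>.
\<close>
lemma tendsto_weighted_means:
  fixes r :: "nat \<Rightarrow> real"
  assumes nonneg: "\<And>n j. j \<le> n \<Longrightarrow> 0 \<le> \<mu> n j"
    and sum1: "\<And>n. (\<Sum>j\<le>n. \<mu> n j) = 1"
    and columns: "\<And>j. (\<lambda>n. \<mu> n j) \<longlonglongrightarrow> 0"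
    and r: "r \<longlonglongrightarrow> l"
  shows "(\<lambda>n. \<Sum>j\<le>n. \<mu> n j * r j) \<longlonglongrightarrow> l"
proof (rule LIMSEQ_I)
  fix e :: real
  assume "e > 0"
  then obtain N where N: "\<And>j. j \<ge> N \<Longrightarrow> \<bar>r j - l\<bar> < e / 2"
    using LIMSEQ_D [OF r, of "e / 2"] by auto
  have "(\<lambda>n. \<Sum>j<N. \<mu> n j * \<bar>r j - l\<bar>) \<longlonglongrightarrow> (\<Sum>j<N. 0 * \<bar>r j - l\<bar>)"
    by (intro tendsto_intros columns)
  then have "(\<lambda>n. \<Sum>j<N. \<mu> n j * \<bar>r j - l\<bar>) \<longlonglongrightarrow> 0"
    by simp
  then have "\<forall>\<^sub>F n in sequentially. (\<Sum>j<N. \<mu> n j * \<bar>r j - l\<bar>) < e / 2"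
    by (rule order_tendstoD(2)) (use \<open>e > 0\<close> in simp)
  then obtain M where M: "\<And>n. n \<ge> M \<Longrightarrow> (\<Sum>j<N. \<mu> n j * \<bar>r j - l\<bar>) < e / 2"
    by (auto simp: eventually_sequentially)
  have "norm ((\<Sum>j\<le>n. \<mu> n j * r j) - l) < e" if n: "n \<ge> max M N" for n
  proof -
    have split: "{..n} = {..<N} \<union> {N..n}" using n by auto
    have "(\<Sum>j\<le>n. \<mu> n j * r j) - l = (\<Sum>j\<le>n. \<mu> n j * r j) - (\<Sum>j\<le>n. \<mu> n j) * l"
      by (simp add: sum1)
    also have "\<dots> = (\<Sum>j\<le>n. \<mu> n j * (r j - l))"
      by (simp add: sum_distrib_right sum_subtractf right_diff_distrib)
    finally have "norm ((\<Sum>j\<le>n. \<mu> n j * r j) - l) \<le> (\<Sum>j\<le>n. \<bar>\<mu> n j * (r j - l)\<bar>)"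
      by (simp add: sum_abs)
    also have "\<dots> = (\<Sum>j\<le>n. \<mu> n j * \<bar>r j - l\<bar>)"
      by (intro sum.cong) (auto simp: abs_mult nonneg)
    also have "\<dots> = (\<Sum>j<N. \<mu> n j * \<bar>r j - l\<bar>) + (\<Sum>j=N..n. \<mu> n j * \<bar>r j - l\<bar>)"
      unfolding split by (rule sum.union_disjoint) auto
    also have "(\<Sum>j=N..n. \<mu> n j * \<bar>r j - l\<bar>) \<le> (\<Sum>j=N..n. \<mu> n j * (e / 2))"
      using N by (intro sum_mono mult_left_mono nonneg) (auto simp: less_imp_le)
    also have "\<dots> \<le> (\<Sum>j\<le>n. \<mu> n j * (e / 2))"
      using nonneg \<open>e > 0\<close> by (intro sum_mono2) auto
    also have "\<dots> = e / 2"
      by (simp only: sum_distrib_right [symmetric] sum1)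
    finally show ?thesis
      using M [of n] n by simp
  qed
  then show "\<exists>no. \<forall>n\<ge>no. norm ((\<Sum>j\<le>n. \<mu> n j * r j) - l) < e" by blast
qed

lemma weighted_variance:
  fixes x :: "'i \<Rightarrow> 'a::real_inner"
  assumes "(\<Sum>j\<in>J. w j) = 1" and m: "m = (\<Sum>j\<in>J. w j *\<^sub>R x j)"
  shows "(\<Sum>j\<in>J. w j * (norm (x j - p))\<^sup>2) = (norm (m - p))\<^sup>2 + (\<Sum>j\<in>J. w j * (norm (x j - m))\<^sup>2)"
proof -
  have "(\<Sum>j\<in>J. w j * inner (x j - m) (m - p)) = inner (\<Sum>j\<in>J. w j *\<^sub>R (x j - m)) (m - p)"
    by (simp add: inner_sum_left)
  also have "(\<Sum>j\<in>J. w j *\<^sub>R (x j - m)) = 0"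
    using assms by (simp add: scaleR_diff_right sum_subtractf flip: scaleR_left.sum)
  finally have cross: "(\<Sum>j\<in>J. w j * inner (x j - m) (m - p)) = 0" by simp
  have "(norm (x j - p))\<^sup>2 = (norm (m - p))\<^sup>2 + (norm (x j - m))\<^sup>2 + 2 * inner (x j - m) (m - p)" for j
    by (simp add: power2_norm_eq_inner inner_diff inner_commute)
  then have "w j * (norm (x j - p))\<^sup>2 = w j * (norm (m - p))\<^sup>2 + w j * (norm (x j - m))\<^sup>2
      + 2 * (w j * inner (x j - m) (m - p))" for j
    by (simp only: distrib_left mult.left_commute)
  then have "(\<Sum>j\<in>J. w j * (norm (x j - p))\<^sup>2)
      = (\<Sum>j\<in>J. w j * (norm (m - p))\<^sup>2) + (\<Sum>j\<in>J. w j * (norm (x j - m))\<^sup>2)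
        + 2 * (\<Sum>j\<in>J. w j * inner (x j - m) (m - p))"
    by (simp only: sum.distrib sum_distrib_left)
  also have "(\<Sum>j\<in>J. w j * (norm (m - p))\<^sup>2) = (norm (m - p))\<^sup>2"
    by (simp only: sum_distrib_right [symmetric] assms(1) mult_1)
  finally show ?thesis using cross by simp
qed

text \<open>
  The distances to a fixed point \<open>p\<close> converge by the hypothesis on \<open>\<xi>\<close>, to \<open>l\<close> say. The distance
  from \<open>xbar n\<close> to \<open>p\<close> is squeezed between \<open>\<parallel>x (Suc n) - p\<parallel> - \<epsilon> n\<close> and a weighted mean of earlier
  distances, so it converges to \<open>l\<close> too. By \<open>weighted_variance\<close>, the spread of the \<open>x j\<close> about
  \<open>xbar n\<close> then tends to \<open>0\<close>, and the terms \<open>j = n\<close> and \<open>j = n - 1\<close> of that sum have weights bounded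
  away from \<open>0\<close>.
\<close>
lemma mean_iteration:
  fixes x xbar :: "nat \<Rightarrow> 'a::real_inner" and \<mu> :: "nat \<Rightarrow> nat \<Rightarrow> real"
  assumes mu_nonneg: "\<And>n j. j \<le> n \<Longrightarrow> \<mu> n j \<ge> 0"
    and sum1: "\<And>n. (\<Sum>j\<le>n. \<mu> n j) = 1"
    and columns: "\<And>j. (\<lambda>n. \<mu> n j) \<longlonglongrightarrow> 0"
    and concentrating: "\<And>\<xi> :: nat \<Rightarrow> real.
      (\<And>n. \<xi> n \<ge> 0) \<Longrightarrow>
      (\<exists>\<epsilon> :: nat \<Rightarrow> real. (\<forall>n. \<epsilon> n \<ge> 0) \<and> summable \<epsilon> \<and>
         (\<forall>n. \<xi> (Suc n) \<le> (\<Sum>j\<le>n. \<mu> n j * \<xi> j) + \<epsilon> n)) \<Longrightarrow>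
      convergent \<xi>"
    and diagonal: "(INF n. \<mu> (Suc n) n * \<mu> (Suc n) (Suc n)) > 0"
    and xbar_def: "\<And>n. xbar n = (\<Sum>j\<le>n. \<mu> n j *\<^sub>R x j)"
    and nonexpansive: "\<And>u v. norm (T u - T v) \<le> norm (u - v)"
    and fixpoint: "T p = p"
    and err: "\<And>n. norm (x (Suc n) - T (xbar n)) \<le> \<epsilon> n" and "summable \<epsilon>"
  shows "convergent (\<lambda>n. norm (x n - p))"
    and "(\<lambda>n. x n - xbar n) \<longlonglongrightarrow> 0"
    and "(\<lambda>n. x (Suc n) - xbar n) \<longlonglongrightarrow> 0"
proof -
  have eps_nonneg: "0 \<le> \<epsilon> n" for n
    using err [of n] norm_ge_zero order_trans by blast
  have step: "norm (x (Suc n) - p) \<le> norm (xbar n - p) + \<epsilon> n" for n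
    using norm_triangle_ineq [of "x (Suc n) - T (xbar n)" "T (xbar n) - p"]
      nonexpansive [of "xbar n" p] err [of n] fixpoint by simp
  have mean_le: "norm (xbar n - p) \<le> (\<Sum>j\<le>n. \<mu> n j * norm (x j - p))" for n
  proof -
    have "xbar n - p = (\<Sum>j\<le>n. \<mu> n j *\<^sub>R (x j - p))"
      by (simp add: xbar_def scaleR_diff_right sum_subtractf sum1 flip: scaleR_left.sum)
    also have "norm \<dots> \<le> (\<Sum>j\<le>n. norm (\<mu> n j *\<^sub>R (x j - p)))"
      by (rule norm_sum)
    also have "\<dots> = (\<Sum>j\<le>n. \<mu> n j * norm (x j - p))"
      by (intro sum.cong) (auto simp: mu_nonneg)
    finally show ?thesis .
  qed
  show conv: "convergent (\<lambda>n. norm (x n - p))"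
  proof (rule concentrating)
    have "norm (x (Suc n) - p) \<le> (\<Sum>j\<le>n. \<mu> n j * norm (x j - p)) + \<epsilon> n" for n
      using step [of n] mean_le [of n] by simp
    then show "\<exists>\<epsilon>. (\<forall>n. 0 \<le> \<epsilon> n) \<and> summable \<epsilon> \<and>
        (\<forall>n. norm (x (Suc n) - p) \<le> (\<Sum>j\<le>n. \<mu> n j * norm (x j - p)) + \<epsilon> n)"
      using eps_nonneg \<open>summable \<epsilon>\<close> by blast
  qed simp
  then obtain l where l: "(\<lambda>n. norm (x n - p)) \<longlonglongrightarrow> l"
    by (auto simp: convergent_def)
  have mean_lim: "(\<lambda>n. norm (xbar n - p)) \<longlonglongrightarrow> l"
  proof (rule tendsto_sandwich)
    show "(\<lambda>n. norm (x (Suc n) - p) - \<epsilon> n) \<longlonglongrightarrow> l"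
      using tendsto_diff [OF LIMSEQ_Suc [OF l] summable_LIMSEQ_zero [OF \<open>summable \<epsilon>\<close>]] by simp
    show "(\<lambda>n. \<Sum>j\<le>n. \<mu> n j * norm (x j - p)) \<longlonglongrightarrow> l"
      by (intro tendsto_weighted_means mu_nonneg sum1 columns l)
    show "\<forall>\<^sub>F n in sequentially. norm (x (Suc n) - p) - \<epsilon> n \<le> norm (xbar n - p)"
      using step by (simp add: diff_le_eq)
  qed (use mean_le in simp)
  have spread: "(\<lambda>n. \<Sum>j\<le>n. \<mu> n j * (norm (x j - xbar n))\<^sup>2) \<longlonglongrightarrow> 0"
  proof -
    have "(\<lambda>n. (\<Sum>j\<le>n. \<mu> n j * (norm (x j - p))\<^sup>2) - (norm (xbar n - p))\<^sup>2) \<longlonglongrightarrow> l\<^sup>2 - l\<^sup>2"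
      by (intro tendsto_intros tendsto_weighted_means mu_nonneg sum1 columns l mean_lim)
    then show ?thesis
      using weighted_variance [OF sum1 xbar_def, of _ p] by simp
  qed
  define \<delta> where "\<delta> = (INF n. \<mu> (Suc n) n * \<mu> (Suc n) (Suc n))"
  \<comment> \<open>Each of the two factors is at most \<open>1\<close>, so each is at least the product.\<close>
  have \<delta>_le: "\<delta> \<le> \<mu> (Suc n) n" "\<delta> \<le> \<mu> (Suc n) (Suc n)" for n
  proof -
    have "bdd_below (range (\<lambda>n. \<mu> (Suc n) n * \<mu> (Suc n) (Suc n)))"
      by (rule bdd_belowI2 [where m = 0]) (simp add: mu_nonneg)
    then have \<delta>: "\<delta> \<le> \<mu> (Suc n) n * \<mu> (Suc n) (Suc n)"
      unfolding \<delta>_def by (rule cINF_lower) simp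
    have "\<mu> (Suc n) j \<le> 1" if "j \<le> Suc n" for j
      using member_le_sum [of j "{..Suc n}" "\<mu> (Suc n)"] that mu_nonneg sum1 [of "Suc n"] by simp
    then have "\<mu> (Suc n) n * \<mu> (Suc n) (Suc n) \<le> \<mu> (Suc n) n * 1"
        "\<mu> (Suc n) n * \<mu> (Suc n) (Suc n) \<le> 1 * \<mu> (Suc n) (Suc n)"
      by (intro mult_left_mono mult_right_mono mu_nonneg; simp)+
    then show "\<delta> \<le> \<mu> (Suc n) n" "\<delta> \<le> \<mu> (Suc n) (Suc n)"
      using \<delta> by simp_all
  qed
  have near_mean: "(\<lambda>n. x (i n) - xbar (Suc n)) \<longlonglongrightarrow> 0"
    if i: "\<And>n. i n \<le> Suc n" "\<And>n. \<delta> \<le> \<mu> (Suc n) (i n)" for i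
  proof -
    have "(\<lambda>n. \<delta> * (norm (x (i n) - xbar (Suc n)))\<^sup>2) \<longlonglongrightarrow> 0"
    proof (rule tendsto_sandwich [OF _ _ tendsto_const LIMSEQ_Suc [OF spread]])
      have "\<delta> * (norm (x (i n) - xbar (Suc n)))\<^sup>2
          \<le> (\<Sum>j\<le>Suc n. \<mu> (Suc n) j * (norm (x j - xbar (Suc n)))\<^sup>2)" for n
      proof -
        have "\<delta> * (norm (x (i n) - xbar (Suc n)))\<^sup>2 \<le> \<mu> (Suc n) (i n) * (norm (x (i n) - xbar (Suc n)))\<^sup>2"
          by (intro mult_right_mono i) simp
        also have "\<dots> \<le> (\<Sum>j\<le>Suc n. \<mu> (Suc n) j * (norm (x j - xbar (Suc n)))\<^sup>2)"
          using i(1) [of n]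
          by (intro member_le_sum [of "i n" _ "\<lambda>j. \<mu> (Suc n) j * (norm (x j - xbar (Suc n)))\<^sup>2"])
            (auto intro!: mult_nonneg_nonneg mu_nonneg)
        finally show ?thesis .
      qed
      then show "\<forall>\<^sub>F n in sequentially. \<delta> * (norm (x (i n) - xbar (Suc n)))\<^sup>2
          \<le> (\<Sum>j\<le>Suc n. \<mu> (Suc n) j * (norm (x j - xbar (Suc n)))\<^sup>2)"
        by simp
    qed (use diagonal in \<open>simp add: \<delta>_def less_imp_le\<close>)
    then have "(\<lambda>n. (1 / \<delta>) * (\<delta> * (norm (x (i n) - xbar (Suc n)))\<^sup>2)) \<longlonglongrightarrow> 0"
      by (rule tendsto_mult_right_zero)
    then have "(\<lambda>n. (norm (x (i n) - xbar (Suc n)))\<^sup>2) \<longlonglongrightarrow> 0"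
      using diagonal by (simp add: \<delta>_def [symmetric])
    then have "(\<lambda>n. norm (x (i n) - xbar (Suc n))) \<longlonglongrightarrow> 0"
      using tendsto_real_sqrt [of "\<lambda>n. (norm (x (i n) - xbar (Suc n)))\<^sup>2" 0] by simp
    then show ?thesis by (rule tendsto_norm_zero_cancel)
  qed
  have next_mean: "(\<lambda>n. x (Suc n) - xbar (Suc n)) \<longlonglongrightarrow> 0"
    using near_mean [of Suc] \<delta>_le by simp
  then show same_mean: "(\<lambda>n. x n - xbar n) \<longlonglongrightarrow> 0"
    by (rule LIMSEQ_imp_Suc)
  have "(\<lambda>n. x n - xbar (Suc n)) \<longlonglongrightarrow> 0"
    using near_mean [of "\<lambda>n. n"] \<delta>_le by simp
  from tendsto_add [OF tendsto_diff [OF next_mean this] same_mean]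
  show "(\<lambda>n. x (Suc n) - xbar n) \<longlonglongrightarrow> 0"
    by simp
qed

section \<open>The mean-value splitting algorithm\<close>

theorem proposition4p6:
  fixes A B :: "'a::{real_inner, complete_space} \<Rightarrow> 'a set"
    and \<gamma> :: real
    and a b x xbar y z :: "nat \<Rightarrow> 'a"
    and x\<^sub>0 :: 'a
    and \<mu> :: "nat \<Rightarrow> nat \<Rightarrow> real"
  assumes A: "maximally_monotone A"
    and B: "maximally_monotone B"
    and zer: "zer (op_plus A B) \<noteq> {}"
    and gamma: "\<gamma> > 0"
    and a: "summable (\<lambda>n. norm (a n))"
    and b: "summable (\<lambda>n. norm (b n))"
    and mu_nonneg: "\<And>n j. j \<le> n \<Longrightarrow> \<mu> n j \<ge> 0"
    and A1: "bdd_above (range (\<lambda>n. \<Sum>j\<le>n. \<bar>\<mu> n j\<bar>))"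
    and A2: "\<And>n. (\<Sum>j\<le>n. \<mu> n j) = 1"
    and A3: "\<And>j. (\<lambda>n. \<mu> n j) \<longlonglongrightarrow> 0"
    and A4: "\<And>\<xi> :: nat \<Rightarrow> real.
      (\<And>n. \<xi> n \<ge> 0) \<Longrightarrow>
      (\<exists>\<epsilon> :: nat \<Rightarrow> real. (\<forall>n. \<epsilon> n \<ge> 0) \<and> summable \<epsilon> \<and>
         (\<forall>n. \<xi> (Suc n) \<le> (\<Sum>j\<le>n. \<mu> n j * \<xi> j) + \<epsilon> n)) \<Longrightarrow>
      convergent \<xi>"
    and A5: "(INF n. \<mu> (Suc n) n * \<mu> (Suc n) (Suc n)) > 0"
    and x_init: "x 0 = x\<^sub>0"
    and xbar_def: "\<And>n. xbar n = (\<Sum>j\<le>n. \<mu> n j *\<^sub>R x j)"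
    and y_def: "\<And>n. y n = resolvent (op_scale \<gamma> B) (xbar n) + b n"
    and z_def: "\<And>n. z n = resolvent (op_scale \<gamma> A) (2 *\<^sub>R y n - xbar n) + a n"
    and x_step: "\<And>n. x (Suc n) = xbar n + 2 *\<^sub>R (z n - y n)"
  shows "\<exists>x'\<in>Fix (reflector (op_scale \<gamma> A) \<circ> reflector (op_scale \<gamma> B)).
    x \<rightharpoonup> x' \<and> xbar \<rightharpoonup> x' \<and>
    (let y' = resolvent (op_scale \<gamma> B) x'
     in y' \<in> zer (op_plus A B) \<and>
        (\<lambda>n. z n - y n) \<longlonglongrightarrow> 0 \<and>
        y \<rightharpoonup> y' \<and> z \<rightharpoonup> y')"
proof -
  let ?A = "op_scale \<gamma> A" and ?B = "op_scale \<gamma> B"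
  define JA where "JA = resolvent ?A"
  define JB where "JB = resolvent ?B"
  define T where "T = reflector ?A \<circ> reflector ?B"
  have A': "maximally_monotone ?A" and B': "maximally_monotone ?B"
    using A B gamma by (simp_all add: maximally_monotone_scale)
  have T_eq: "T u = u + 2 *\<^sub>R (JA (2 *\<^sub>R JB u - u) - JB u)" for u
    by (simp add: T_def JA_def JB_def reflector_def algebra_simps)
  have T_nonexpansive: "norm (T u - T v) \<le> norm (u - v)" for u v
    unfolding T_def o_def
    using reflector_nonexpansive [OF A'] reflector_nonexpansive [OF B'] order_trans by blast
  \<comment> \<open>The dictionary between fixed points of \<open>T\<close> and zeros of \<open>A + B\<close>: it turns a zero into the fixed
      point \<open>p\<close> below, and recognizes the weak limits.\<close>
  have zero_iff: "JB u = v \<and> u \<in> Fix T \<longleftrightarrow> u - v \<in> ?B v \<and> v - u \<in> ?A v" for u v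
  proof -
    have "JB u = v \<longleftrightarrow> u - v \<in> ?B v"
      unfolding JB_def by (rule resolvent_eq_iff [OF B'])
    moreover have "JA (2 *\<^sub>R v - u) = v \<longleftrightarrow> v - u \<in> ?A v"
      unfolding JA_def resolvent_eq_iff [OF A'] by (simp add: scaleR_2)
    ultimately show ?thesis
      by (auto simp: Fix_def T_eq)
  qed
  have a_lim: "a \<longlonglongrightarrow> 0" and b_lim: "b \<longlonglongrightarrow> 0"
    using summable_LIMSEQ_zero [OF a] summable_LIMSEQ_zero [OF b]
    by (simp_all add: tendsto_norm_zero_cancel)

  have error: "norm (x (Suc n) - T (xbar n)) \<le> 2 * norm (a n) + 2 * norm (b n)" for n
  proof -
    define r where "r = reflector ?A (2 *\<^sub>R y n - xbar n) - reflector ?A (reflector ?B (xbar n))"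
    have "norm r \<le> norm ((2 *\<^sub>R y n - xbar n) - reflector ?B (xbar n))"
      unfolding r_def by (rule reflector_nonexpansive [OF A'])
    also have "(2 *\<^sub>R y n - xbar n) - reflector ?B (xbar n) = 2 *\<^sub>R b n"
      by (simp add: y_def reflector_def algebra_simps)
    finally have "norm r \<le> 2 * norm (b n)" by simp
    moreover have "x (Suc n) - T (xbar n) = r + 2 *\<^sub>R a n"
      unfolding r_def T_def x_step
      by (simp add: z_def reflector_def [of ?A] algebra_simps)
    ultimately show ?thesis
      using norm_triangle_ineq [of r "2 *\<^sub>R a n"] by simp
  qed
  have error_summable: "summable (\<lambda>n. 2 * norm (a n) + 2 * norm (b n))"
    using a b by (intro summable_add summable_mult)
  note mean = mean_iteration [OF mu_nonneg A2 A3 A4 A5 xbar_def T_nonexpansive _ error error_summable]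

  obtain p where p: "T p = p"
  proof -
    obtain s u v where "u \<in> A s" "v \<in> B s" "0 = u + v"
      using zer unfolding zer_def op_plus_def by blast
    then have "v \<in> B s" "- v \<in> A s"
      by (simp_all add: eq_neg_iff_add_eq_0 [symmetric])
    then have "\<gamma> *\<^sub>R v \<in> ?B s" "- (\<gamma> *\<^sub>R v) \<in> ?A s"
      unfolding op_scale_def scaleR_minus_right [symmetric] by blast+
    then have "s + \<gamma> *\<^sub>R v \<in> Fix T"
      using zero_iff [of "s + \<gamma> *\<^sub>R v" s] by simp
    then show thesis using that by (simp add: Fix_def)
  qed
  have x_mean: "(\<lambda>n. x n - xbar n) \<longlonglongrightarrow> 0"
    by (rule mean(2) [OF _ _ _ p]) assumption+
  have "(\<lambda>n. x (Suc n) - xbar n) \<longlonglongrightarrow> 0"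
    by (rule mean(3) [OF _ _ _ p]) assumption+
  then have "(\<lambda>n. (1/2) *\<^sub>R (x (Suc n) - xbar n)) \<longlonglongrightarrow> (1/2) *\<^sub>R 0"
    by (rule tendsto_scaleR [OF tendsto_const])
  then have zy: "(\<lambda>n. z n - y n) \<longlonglongrightarrow> 0"
    by (simp add: x_step)
  have dist_conv: "convergent (\<lambda>n. norm (xbar n - s))" if "s \<in> Fix T" for s
  proof -
    have "convergent (\<lambda>n. norm (x n - s))"
      by (rule mean(1)) (use that in \<open>simp_all add: Fix_def\<close>)
    then obtain l where l: "(\<lambda>n. norm (x n - s)) \<longlonglongrightarrow> l"
      by (auto simp: convergent_def)
    have "(\<lambda>n. norm (xbar n - s) - norm (x n - s)) \<longlonglongrightarrow> 0"
    proof (rule Lim_null_comparison [OF always_eventually tendsto_norm_zero [OF x_mean]])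
      show "\<forall>n. norm (norm (xbar n - s) - norm (x n - s)) \<le> norm (x n - xbar n)"
        using norm_triangle_ineq3 [of "xbar n - s" "x n - s" for n]
        by (simp add: norm_minus_commute)
    qed
    from tendsto_add [OF this l] show ?thesis
      by (auto simp: convergent_def)
  qed
  obtain C where C: "\<And>n. norm (xbar n) \<le> C"
  proof -
    have "Bseq (\<lambda>n. norm (xbar n - p))"
      using dist_conv [of p] p by (intro convergent_imp_Bseq) (simp add: Fix_def)
    then obtain D where "\<And>n. norm (xbar n - p) \<le> D"
      by (auto simp: Bseq_def)
    then have "norm (xbar n) \<le> D + norm p" for n
      using norm_triangle_ineq [of "xbar n - p" p] by (smt (verit) diff_add_cancel)
    then show thesis using that by blast
  qed
  define P where "P n = JB (xbar n)" for n
  have P_bound: "norm (P n) \<le> C + norm (JB 0)" for n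
  proof -
    have "norm (P n - JB 0) \<le> norm (xbar n)"
      using resolvent_nonexpansive [OF B', of "xbar n" 0] by (simp add: P_def JB_def)
    then show ?thesis
      using norm_triangle_ineq [of "P n - JB 0" "JB 0"] C [of n] by simp
  qed
  have y_P: "y n = P n + b n" for n
    by (simp add: y_def P_def JB_def)

  \<comment> \<open>\<open>xbar n - P n\<close> and \<open>2 y n - xbar n - Q n\<close> are the elements of \<open>\<gamma>B (P n)\<close> and \<open>\<gamma>A (Q n)\<close> that
      the two resolvent steps produce; their sum and \<open>Q n - P n\<close> are \<open>z n - y n\<close> up to sign and errors.\<close>
  have limits: "JB x' = v \<and> x' \<in> Fix T"
    if G: "G \<le> sequentially" "G \<noteq> bot"
      and x': "weakly_tendsto xbar x' G" and v: "weakly_tendsto P v G" for G x' v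
  proof -
    define Q where "Q n = z n - a n" for n
    have V: "xbar n - P n \<in> ?B (P n)" for n
      unfolding P_def JB_def by (rule resolvent_in [OF B'])
    have W: "2 *\<^sub>R y n - xbar n - Q n \<in> ?A (Q n)" for n
      using resolvent_in [OF A', of "2 *\<^sub>R y n - xbar n"] by (simp add: Q_def z_def)
    have V_bound: "norm (xbar n - P n) \<le> C + (C + norm (JB 0))" for n
      using norm_triangle_ineq4 [of "xbar n" "P n"] C [of n] P_bound [of n] by simp
    have "(\<lambda>n. (z n - y n) - a n + b n) \<longlonglongrightarrow> 0 - 0 + 0"
      by (intro tendsto_intros zy a_lim b_lim)
    then have QP: "((\<lambda>n. Q n - P n) \<longlongrightarrow> 0) G"
      by (intro tendsto_mono [OF G(1)]) (simp add: Q_def y_P algebra_simps)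
    have "(\<lambda>n. - (z n - y n) + a n + b n) \<longlonglongrightarrow> - 0 + 0 + 0"
      by (intro tendsto_intros zy a_lim b_lim)
    then have VW: "((\<lambda>n. (xbar n - P n) + (2 *\<^sub>R y n - xbar n - Q n)) \<longlongrightarrow> 0) G"
      by (intro tendsto_mono [OF G(1)]) (simp add: Q_def y_P scaleR_2 algebra_simps)
    note graphs = weak_limit_in_both_graphs [OF A' B' G(2) V W v weakly_tendsto_diff [OF x' v]
        P_bound V_bound QP VW]
    show ?thesis
      using zero_iff [of x' v] graphs by simp
  qed
  have "\<exists>x'\<in>Fix T. weakly_tendsto xbar x' sequentially"
  proof (rule opial [OF C])
    fix G x'
    assume G: "G \<le> sequentially" "G \<noteq> bot" "weakly_tendsto xbar x' G"
    obtain H v where "H \<le> G" "H \<noteq> bot" "weakly_tendsto P v H"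
      using weak_cluster_point [OF G(2), of P, OF P_bound] by blast
    then show "x' \<in> Fix T"
      using limits [of H x' v] order_trans [of H G sequentially] weakly_tendsto_mono [of xbar x' G H] G
      by blast
  qed (rule dist_conv)
  then obtain x' where x': "x' \<in> Fix T" "weakly_tendsto xbar x' sequentially" by blast
  have P_lim: "weakly_tendsto P (JB x') sequentially"
  proof (rule weakly_tendsto_if_unique_cluster_point [OF P_bound])
    fix G v
    assume "G \<le> sequentially" "G \<noteq> bot" "weakly_tendsto P v G"
    then show "v = JB x'"
      using limits [of G x' v] weakly_tendsto_mono [OF x'(2)] by blast
  qed
  have y_lim: "weakly_tendsto y (JB x') sequentially"
    using b_lim by (intro weakly_tendsto_perturb [OF P_lim]) (simp add: y_P)
  have "JB x' \<in> zer (op_plus A B)"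
  proof -
    have "x' - JB x' \<in> ?B (JB x')" "JB x' - x' \<in> ?A (JB x')"
      using zero_iff [of x' "JB x'"] x'(1) by auto
    then obtain u v where "u \<in> A (JB x')" "v \<in> B (JB x')"
        "x' - JB x' = \<gamma> *\<^sub>R v" "JB x' - x' = \<gamma> *\<^sub>R u"
      by (auto simp: op_scale_def)
    moreover from this have "\<gamma> *\<^sub>R (u + v) = 0"
      by (simp add: scaleR_add_right flip: \<open>x' - JB x' = \<gamma> *\<^sub>R v\<close> \<open>JB x' - x' = \<gamma> *\<^sub>R u\<close>)
    then have "u + v = 0" using gamma by simp
    ultimately show ?thesis
      unfolding zer_def op_plus_def by force
  qed
  moreover have "weakly_tendsto x x' sequentially"
    by (rule weakly_tendsto_perturb [OF x'(2) x_mean])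
  moreover have "weakly_tendsto z (JB x') sequentially"
    by (rule weakly_tendsto_perturb [OF y_lim zy])
  ultimately show ?thesis
    using x' y_lim zy
    unfolding Let_def weakly_tendsto_def weakly_converges_def T_def JB_def by blast
qed

end
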